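(* Let $\mathbb{F}$ be any field, let $p,q\ge 1$ be integers, let $m\in\{1,2\}$, and let $A_1,\ldots,A_m\in M_{p,q}(\mathbb{F})$ be linearly independent over $\mathbb{F}$. Then for every $(g_1,\ldots,g_m)\in\mathbb{F}^m$ the bilinear system $$y^TA_ix=g_i,\quad i=1,\ldots,m,$$ is solvable, i.e. there exist $x\in\mathbb{F}^q$ and $y\in\mathbb{F}^p$ satisfying all $m$ equations simultaneously.
   Context: $M_{p,q}(\mathbb{F})$ denotes the $p$-by-$q$ matrices over $\mathbb{F}$. *)

theory Defs
  imports "Jordan_Normal_Form.Matrix"
begin

text \<open>Linear independence of the family \<open>A 1, \<dots>, A m\<close> (not merely of the set of its members,
  so that a repeated matrix makes the family dependent) in the space of \<open>p \<times> q\<close> matrices.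
  The sum is taken in \<^const>\<open>module_mat\<close> because the type \<^typ>\<open>'a mat\<close> comprises matrices of
  all dimensions and hence has no zero element; it is meaningful only if all \<open>A i\<close> are
  \<open>p \<times> q\<close> matrices.\<close>

definition lin_indep_mats :: "nat \<Rightarrow> nat \<Rightarrow> nat \<Rightarrow> (nat \<Rightarrow> 'a :: field mat) \<Rightarrow> bool" where
  "lin_indep_mats p q m A \<longleftrightarrow>
     (\<forall>c :: nat \<Rightarrow> 'a.
        finsum (module_mat TYPE('a) p q) (\<lambda>i. c i \<cdot>\<^sub>m A i) {1..m} = 0\<^sub>m p q \<longrightarrow>
        (\<forall>i\<in>{1..m}. c i = 0))"

end

theory Submission
  imports Defs
begin

text \<open>For \<open>m = 2\<close> write \<open>v i j = (a i j, b i j)\<close> for the pairs of corresponding entries and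
  \<open>\<and>\<close> for the determinant of two such pairs. A vector \<open>x\<close> with \<open>A x\<close> and \<open>B x\<close> independent
  (or a vector \<open>y\<close> with \<open>y\<^sup>T A\<close> and \<open>y\<^sup>T B\<close> independent) makes every right-hand side attainable.
  Independence of the matrices gives \<open>v i j \<and> v k l \<noteq> 0\<close> for some positions. If all unit vectors
  fail, then pairs in a common row or column are parallel, so \<open>v i l\<close> and \<open>v k j\<close>, each parallel
  to both \<open>v i j\<close> and \<open>v k l\<close>, vanish; then \<open>x = e\<^sub>j + e\<^sub>l\<close> works.\<close>

text \<open>If \<open>A 1\<close> were zero, the coefficient 1 would give a nontrivial
  relation.\<close>

lemma lin_indep_mats_1D:
  fixes A :: "nat \<Rightarrow> 'a :: field mat"
  assumes "lin_indep_mats p q 1 A"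
  shows "A 1 \<noteq> 0\<^sub>m p q"
proof
  interpret abelian_group "module_mat TYPE('a) p q" by (rule abelian_group_mat)
  assume A: "A 1 = 0\<^sub>m p q"
  have "finsum (module_mat TYPE('a) p q) (\<lambda>i. 1 \<cdot>\<^sub>m A i) {1..1} = 0\<^sub>m p q"
    using finsum_insert[of "{}" "1::nat" "\<lambda>i. 1 \<cdot>\<^sub>m A i"] A
    by (auto simp: module_mat_simps)
  then show False
    using assms unfolding lin_indep_mats_def
    by (auto dest: spec[of _ "\<lambda>_. 1"])
qed

text \<open>Turns the \<open>finsum\<close> of the definition into ordinary matrix addition, the
  form in which a relation is later exhibited.\<close>

lemma lin_indep_mats_2D:
  fixes A :: "nat \<Rightarrow> 'a :: field mat"
  assumes A: "A 1 \<in> carrier_mat p q" "A 2 \<in> carrier_mat p q"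
    and indep: "lin_indep_mats p q 2 A"
    and comb: "s \<cdot>\<^sub>m A 1 + t \<cdot>\<^sub>m A 2 = 0\<^sub>m p q"
  shows "s = 0 \<and> t = 0"
proof -
  interpret abelian_group "module_mat TYPE('a) p q" by (rule abelian_group_mat)
  define c where "c = (\<lambda>i::nat. if i = 1 then s else t)"
  have "finsum (module_mat TYPE('a) p q) (\<lambda>i. c i \<cdot>\<^sub>m A i) {1, 2} = s \<cdot>\<^sub>m A 1 + t \<cdot>\<^sub>m A 2"
    using A finsum_insert[of "{2}" "1::nat" "\<lambda>i. c i \<cdot>\<^sub>m A i"]
      finsum_insert[of "{}" "2::nat" "\<lambda>i. c i \<cdot>\<^sub>m A i"]
    by (auto simp: module_mat_simps c_def)
  moreover have "{1..2::nat} = {1, 2}" by auto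
  ultimately have "\<forall>i\<in>{1, 2}. c i = 0"
    using indep comb unfolding lin_indep_mats_def by metis
  then show ?thesis by (simp add: c_def)
qed

text \<open>Lets \<open>x\<close> and \<open>y\<close> exchange roles, so that statements on columns
  transfer to rows.\<close>

lemma bilinear_form_transpose:
  fixes A :: "'a :: comm_semiring_0 mat"
  assumes "A \<in> carrier_mat p q" "x \<in> carrier_vec q" "y \<in> carrier_vec p"
  shows "x \<bullet> (transpose_mat A *\<^sub>v y) = y \<bullet> (A *\<^sub>v x)"
  using transpose_vec_mult_scalar[OF assms]
    comm_scalar_prod[of x q "transpose_mat A *\<^sub>v y"] assms by simp

text \<open>Cramer's rule: a \<open>y\<close> supported on the coordinates \<open>i\<close> and
  \<open>k\<close> suffices, and its two entries solve a 2-by-2 system with determinant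
  \<open>d\<close>.\<close>

lemma nonzero_minor_solvable:
  fixes u v :: "'a :: field vec"
  assumes uv: "u \<in> carrier_vec p" "v \<in> carrier_vec p" and ik: "i < p" "k < p"
    and minor: "u $ i * v $ k \<noteq> u $ k * v $ i"
  obtains y where "y \<in> carrier_vec p" "y \<bullet> u = g" "y \<bullet> v = h"
proof
  define d where "d = u $ i * v $ k - u $ k * v $ i"
  define s where "s = (g * v $ k - h * u $ k) / d"
  define t where "t = (h * u $ i - g * v $ i) / d"
  define y where "y = s \<cdot>\<^sub>v unit_vec p i + t \<cdot>\<^sub>v unit_vec p k"
  have prod: "y \<bullet> w = s * w $ i + t * w $ k" if "w \<in> carrier_vec p" for w
    using that ik by (simp add: y_def add_scalar_prod_distrib[of _ p])
  have "d \<noteq> 0" using minor by (simp add: d_def)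
  have "s * u $ i + t * u $ k = g * d / d" "s * v $ i + t * v $ k = h * d / d"
    unfolding s_def t_def times_divide_eq_left add_divide_distrib[symmetric]
    by (simp_all add: d_def algebra_simps)
  then have "s * u $ i + t * u $ k = g" "s * v $ i + t * v $ k = h"
    using \<open>d \<noteq> 0\<close> by simp_all
  then show "y \<bullet> u = g" "y \<bullet> v = h" using prod uv by simp_all
  show "y \<in> carrier_vec p" by (simp add: y_def)
qed

lemma pair_solvable_if_minor:
  fixes A B :: "'a :: field mat"
  assumes "A \<in> carrier_mat p q" "B \<in> carrier_mat p q" "x \<in> carrier_vec q" "i < p" "k < p"
    and "(A *\<^sub>v x) $ i * (B *\<^sub>v x) $ k \<noteq> (A *\<^sub>v x) $ k * (B *\<^sub>v x) $ i"
  shows "\<exists>x \<in> carrier_vec q. \<exists>y \<in> carrier_vec p. y \<bullet> (A *\<^sub>v x) = g \<and> y \<bullet> (B *\<^sub>v x) = h"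
  using nonzero_minor_solvable[of "A *\<^sub>v x" p "B *\<^sub>v x" i k g h] assms
  by (metis mult_mat_vec_carrier)

text \<open>The unit vector \<open>x = unit_vec q j\<close> extracts column \<open>j\<close> of both
  matrices.\<close>

lemma pair_solvable_if_column_minor:
  fixes A B :: "'a :: field mat"
  assumes AB: "A \<in> carrier_mat p q" "B \<in> carrier_mat p q" and ij: "i < p" "k < p" "j < q"
    and minor: "A $$ (i, j) * B $$ (k, j) \<noteq> A $$ (k, j) * B $$ (i, j)"
  shows "\<exists>x \<in> carrier_vec q. \<exists>y \<in> carrier_vec p. y \<bullet> (A *\<^sub>v x) = g \<and> y \<bullet> (B *\<^sub>v x) = h"
proof (rule pair_solvable_if_minor[OF AB unit_vec_carrier[of q j] ij(1,2)])
  show "(A *\<^sub>v unit_vec q j) $ i * (B *\<^sub>v unit_vec q j) $ k \<noteq>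
      (A *\<^sub>v unit_vec q j) $ k * (B *\<^sub>v unit_vec q j) $ i"
    using AB ij minor by simp
qed

text \<open>This is the column case for the transposed matrices.\<close>

lemma pair_solvable_if_row_minor:
  fixes A B :: "'a :: field mat"
  assumes AB: "A \<in> carrier_mat p q" "B \<in> carrier_mat p q" and ij: "i < p" "j < q" "l < q"
    and minor: "A $$ (i, j) * B $$ (i, l) \<noteq> A $$ (i, l) * B $$ (i, j)"
  shows "\<exists>x \<in> carrier_vec q. \<exists>y \<in> carrier_vec p. y \<bullet> (A *\<^sub>v x) = g \<and> y \<bullet> (B *\<^sub>v x) = h"
proof -
  have T: "transpose_mat A \<in> carrier_mat q p" "transpose_mat B \<in> carrier_mat q p"
    using AB by auto
  have "\<exists>y \<in> carrier_vec p. \<exists>x \<in> carrier_vec q.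
      x \<bullet> (transpose_mat A *\<^sub>v y) = g \<and> x \<bullet> (transpose_mat B *\<^sub>v y) = h"
    by (rule pair_solvable_if_column_minor[OF T ij(2,3,1)]) (use AB ij minor in simp)
  then show ?thesis
    using bilinear_form_transpose[OF AB(1)] bilinear_form_transpose[OF AB(2)] by metis
qed

lemma pair_solvable_if_entries_independent:
  fixes A B :: "'a :: field mat"
  assumes AB: "A \<in> carrier_mat p q" "B \<in> carrier_mat p q"
    and ij: "i < p" "j < q" "k < p" "l < q"
    and minor: "A $$ (i, j) * B $$ (k, l) \<noteq> A $$ (k, l) * B $$ (i, j)"
  shows "\<exists>x \<in> carrier_vec q. \<exists>y \<in> carrier_vec p. y \<bullet> (A *\<^sub>v x) = g \<and> y \<bullet> (B *\<^sub>v x) = h"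
    (is ?solvable)
proof (rule ccontr)
  assume unsolvable: "\<not> ?solvable"
  have col: "A $$ (i', j') * B $$ (k', j') = A $$ (k', j') * B $$ (i', j')"
    if "i' < p" "k' < p" "j' < q" for i' k' j'
    using pair_solvable_if_column_minor[OF AB that] unsolvable by blast
  have row: "A $$ (i', j') * B $$ (i', l') = A $$ (i', l') * B $$ (i', j')"
    if "i' < p" "j' < q" "l' < q" for i' j' l'
    using pair_solvable_if_row_minor[OF AB that] unsolvable by blast
  \<comment> \<open>A pair \<open>(a, b)\<close> parallel to two independent pairs vanishes:
    multiplying either coordinate by their determinant \<open>?d\<close> gives 0.\<close>
  have parallel_to_both: "a = 0 \<and> b = 0"
    if "A $$ (i, j) * b = a * B $$ (i, j)" "a * B $$ (k, l) = A $$ (k, l) * b" for a b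
  proof -
    let ?d = "A $$ (i, j) * B $$ (k, l) - A $$ (k, l) * B $$ (i, j)"
    have "?d * a = A $$ (i, j) * (a * B $$ (k, l)) - A $$ (k, l) * (a * B $$ (i, j))"
      by (simp add: algebra_simps)
    also have "\<dots> = 0" unfolding that(2) that(1)[symmetric] by (simp add: mult.left_commute)
    finally have da: "?d * a = 0" .
    have "?d * b = (A $$ (i, j) * b) * B $$ (k, l) - (A $$ (k, l) * b) * B $$ (i, j)"
      by (simp add: algebra_simps)
    then have db: "?d * b = 0" unfolding that(1) that(2)[symmetric] by (simp add: mult.assoc mult.commute)
    show ?thesis using da db minor by simp
  qed
  \<comment> \<open>Position \<open>(i, l)\<close> shares its row with \<open>(i, j)\<close> and its
    column with \<open>(k, l)\<close>; for \<open>(k, j)\<close> it is the other way round.\<close>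
  have il: "A $$ (i, l) = 0" "B $$ (i, l) = 0"
    using parallel_to_both[OF row col] ij by auto
  have kj: "A $$ (k, j) = 0" "B $$ (k, j) = 0"
    using parallel_to_both[OF col row] ij by auto
  define x :: "'a vec" where "x = unit_vec q j + unit_vec q l"
  have index: "(M *\<^sub>v x) $ r = M $$ (r, j) + M $$ (r, l)"
    if "M \<in> carrier_mat p q" "r < p" for M r
    using that ij by (simp add: x_def mult_add_distrib_mat_vec[of M p q])
  have "x \<in> carrier_vec q" by (simp add: x_def)
  \<comment> \<open>By the vanishing entries, coordinates \<open>i\<close> and \<open>k\<close> of
    \<open>A *\<^sub>v x\<close> are \<open>A $$ (i, j)\<close> and \<open>A $$ (k, l)\<close>, and
    likewise for \<open>B\<close>, so the minor required here is the assumed one.\<close>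
  from pair_solvable_if_minor[OF AB this ij(1,3)] show False
    using unsolvable minor ij il kj index[OF AB(1)] index[OF AB(2)] by simp
qed

text \<open>Read as vectors of length \<open>p * q\<close>, the matrices have only zero 2-by-2
  minors. A nonzero entry of \<open>A\<close> and the matching entry of \<open>B\<close> then
  provide the coefficients; if \<open>A\<close> is zero, it is itself a relation.\<close>

lemma dependent_if_entries_dependent:
  fixes A B :: "'a :: field mat"
  assumes AB: "A \<in> carrier_mat p q" "B \<in> carrier_mat p q"
    and minors: "\<And>i j k l. \<lbrakk>i < p; j < q; k < p; l < q\<rbrakk> \<Longrightarrow>
      A $$ (i, j) * B $$ (k, l) = A $$ (k, l) * B $$ (i, j)"
  obtains s t where "s \<noteq> 0 \<or> t \<noteq> 0" "s \<cdot>\<^sub>m A + t \<cdot>\<^sub>m B = 0\<^sub>m p q"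
proof (cases "\<exists>i<p. \<exists>j<q. A $$ (i, j) \<noteq> 0")
  case True
  then obtain i j where ij: "i < p" "j < q" "A $$ (i, j) \<noteq> 0" by blast
  have "- B $$ (i, j) \<cdot>\<^sub>m A + A $$ (i, j) \<cdot>\<^sub>m B = 0\<^sub>m p q"
    using AB minors[OF ij(1,2)] by (intro eq_matI) (auto simp: mult.commute)
  then show ?thesis using that ij(3) by blast
next
  case False
  then have "1 \<cdot>\<^sub>m A + 0 \<cdot>\<^sub>m B = 0\<^sub>m p q"
    using AB by (intro eq_matI) auto
  then show ?thesis using that[of 1 0] by simp
qed

lemma single_solvable:
  fixes A :: "'a :: field mat"
  assumes A: "A \<in> carrier_mat p q" and nz: "A \<noteq> 0\<^sub>m p q"
  shows "\<exists>x \<in> carrier_vec q. \<exists>y \<in> carrier_vec p. y \<bullet> (A *\<^sub>v x) = g"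
proof -
  obtain i j where ij: "i < p" "j < q" "A $$ (i, j) \<noteq> 0"
    using A nz by (metis eq_matI carrier_matD index_zero_mat)
  \<comment> \<open>The unit vectors pick out the entry \<open>A $$ (i, j)\<close>, and the scaling
    turns it into \<open>g\<close>.\<close>
  then have "(g / A $$ (i, j) \<cdot>\<^sub>v unit_vec p i) \<bullet> (A *\<^sub>v unit_vec q j) = g"
    using A by simp
  then show ?thesis by (meson smult_carrier_vec unit_vec_carrier)
qed

theorem theorem5p1:
  fixes A :: "nat \<Rightarrow> 'a :: field mat"
    and g :: "nat \<Rightarrow> 'a"
    and p q m :: nat
  assumes "p \<ge> 1" and "q \<ge> 1"
    and "m \<in> {1, 2}"
    and "\<And>i. i \<in> {1..m} \<Longrightarrow> A i \<in> carrier_mat p q"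
    and "lin_indep_mats p q m A"
  shows "\<exists>x \<in> carrier_vec q. \<exists>y \<in> carrier_vec p.
           \<forall>i \<in> {1..m}. y \<bullet> (A i *\<^sub>v x) = g i"
proof (cases "m = 1")
  case True
  then have "A 1 \<in> carrier_mat p q" using assms(4) by simp
  then have "\<exists>x \<in> carrier_vec q. \<exists>y \<in> carrier_vec p. y \<bullet> (A 1 *\<^sub>v x) = g 1"
    using lin_indep_mats_1D[of p q A] assms(5) True by (intro single_solvable) simp_all
  then show ?thesis using True by simp
next
  case False
  then have m: "m = 2" using assms(3) by simp
  then have A: "A 1 \<in> carrier_mat p q" "A 2 \<in> carrier_mat p q" using assms(4) by simp_all
  \<comment> \<open>Otherwise all minors vanish, which yields a nontrivial relation between
    \<open>A 1\<close> and \<open>A 2\<close>.\<close>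
  have "\<exists>i<p. \<exists>j<q. \<exists>k<p. \<exists>l<q. A 1 $$ (i, j) * A 2 $$ (k, l) \<noteq> A 1 $$ (k, l) * A 2 $$ (i, j)"
    using dependent_if_entries_dependent[OF A] lin_indep_mats_2D[of A, OF A] assms(5) m by metis
  then have "\<exists>x \<in> carrier_vec q. \<exists>y \<in> carrier_vec p.
      y \<bullet> (A 1 *\<^sub>v x) = g 1 \<and> y \<bullet> (A 2 *\<^sub>v x) = g 2"
    using pair_solvable_if_entries_independent[OF A] by blast
  moreover have "{1..m} = {1, 2}" using m by auto
  ultimately show ?thesis by simp
qed

end
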